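(* Let $\mathcal{Q}$ be a small quantaloid, let $\mathbb{A}$ and $\mathbb{B}$ be $\widehat{\mathcal{P}}$-algebras, and let $\zeta\colon\mathbb{A}\to\mathbb{B}$ be a left adjoint $\mathcal{Q}$-distributor. Then $\zeta$ is a $\widehat{\mathcal{P}}$-algebra homomorphism if and only if $\zeta$ is a right adjoint $\mathcal{Q}$-distributor.
   Context: A quantaloid $\mathcal{Q}$ is a category whose hom-sets are complete lattices and whose composition preserves arbitrary joins in each variable; here $\mathcal{Q}$ is small, with object set $\mathcal{Q}_0$. For $f\colon X\to Y$, $g\colon Y\to Z$, $h\colon X\to Z$ in $\mathcal{Q}$, the implications are defined by $g\circ f\leq h\iff g\leq h\swarrow f\iff f\leq g\searrow h$. In a quantaloid, $f\colon X\to Y$ is left adjoint to $g\colon Y\to X$ ($f\dashv g$, and $g$ is right adjoint) if $1_X\leq g\circ f$ and $f\circ g\leq 1_Y$; when it exists the right adjoint of $f$ is unique and denoted $f^*$. A $\mathcal{Q}$-category $\mathbb{A}$ is a set $\mathbb{A}_0$ with a type map $|\cdot|\colon\mathbb{A}_0\to\mathcal{Q}_0$ and arrows $\mathbb{A}(x,y)\in\mathcal{Q}(|x|,|y|)$ with $1_{|x|}\leq\mathbb{A}(x,x)$ and $\mathbb{A}(y,z)\circ\mathbb{A}(x,y)\leq\mathbb{A}(x,z)$. A $\mathcal{Q}$-functor $F\colon\mathbb{A}\to\mathbb{B}$ is a type-preserving map with $\mathbb{A}(x,y)\leq\mathbb{B}(Fx,Fy)$. A $\mathcal{Q}$-distributor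 $\varphi\colon\mathbb{A}\to\mathbb{B}$ is a family $\varphi(x,y)\in\mathcal{Q}(|x|,|y|)$ ($x\in\mathbb{A}_0,y\in\mathbb{B}_0$) with $\mathbb{B}(y',y)\circ\varphi(x,y')\leq\varphi(x,y)$ and $\varphi(x',y)\circ\mathbb{A}(x,x')\leq\varphi(x,y)$. With pointwise order, composition $(\psi\circ\varphi)(x,z)=\bigvee_{y}\psi(y,z)\circ\varphi(x,y)$ and identities $\mathbb{A}$ (the hom-arrows), $\mathcal{Q}$-categories and $\mathcal{Q}$-distributors form a quantaloid $\mathcal{Q}\text{-}\mathbf{Dist}$; left/right adjoint $\mathcal{Q}$-distributors and implications of distributors are taken in this quantaloid. $\mathbf{Map}(\mathcal{Q}\text{-}\mathbf{Dist})$ is its subcategory of all $\mathcal{Q}$-categories and left adjoint $\mathcal{Q}$-distributors. A $\mathcal{Q}$-functor $F\colon\mathbb{A}\to\mathbb{B}$ has graph $F_\natural\colon\mathbb{A}\to\mathbb{B}$, $F_\natural(x,y)=\mathbb{B}(Fx,y)$, and cograph $F^\natural\colon\mathbb{B}\to\mathbb{A}$, $F^\natural(y,x)=\mathbb{B}(y,Fx)$, with $F_\natural\dashv F^\natural$. $*_X$ is the $\mathcal{Q}$-category with one object of type $X$ and hom-arrow $1_X$. The presheaf category $\mathcal{P}\mathbb{A}$ has as objects of type $X$ the $\mathcal{Q}$-distributors $\mu\colon\mathbb{A}\to *_X$, with $\mathcal{P}\mathbb{A}(\mu,\mu')=\mu'\swarrow\mu$. The Yoneda embedding is $\mathsf{Y}_{\mathbb{A}}\colon\mathbb{A}\to\mathcal{P}\mathbb{A}$,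 $a\mapsto\mathbb{A}(-,a)$. The presheaf monad $(\widehat{\mathcal{P}},\mathsf{m},\iota)$ on $\mathbf{Map}(\mathcal{Q}\text{-}\mathbf{Dist})$: $\widehat{\mathcal{P}}\mathbb{A}=\mathcal{P}\mathbb{A}$; for a left adjoint $\zeta\colon\mathbb{A}\to\mathbb{B}$, $\widehat{\mathcal{P}}\zeta=(\zeta^{\rightarrow})_\natural$ where $\zeta^{\rightarrow}\colon\mathcal{P}\mathbb{A}\to\mathcal{P}\mathbb{B}$, $\zeta^{\rightarrow}(\mu)=\mu\circ\zeta^*$; $\iota_{\mathbb{A}}=(\mathsf{Y}_{\mathbb{A}})_\natural$; $\mathsf{m}_{\mathbb{A}}=(\sup_{\mathcal{P}\mathbb{A}})_\natural$, where $\sup_{\mathcal{P}\mathbb{A}}(\Phi)=\Phi\circ(\mathsf{Y}_{\mathbb{A}})_\natural$. A $\widehat{\mathcal{P}}$-algebra is a pair $(\mathbb{A},\varphi)$ with $\varphi\colon\mathcal{P}\mathbb{A}\to\mathbb{A}$ a left adjoint $\mathcal{Q}$-distributor that is right adjoint to $(\mathsf{Y}_{\mathbb{A}})_\natural$; necessarily $\varphi=(\mathsf{Y}_{\mathbb{A}})^\natural$. A $\widehat{\mathcal{P}}$-algebra homomorphism from $\mathbb{A}$ to $\mathbb{B}$ is a left adjoint $\mathcal{Q}$-distributor $\zeta\colon\mathbb{A}\to\mathbb{B}$ with $(\mathsf{Y}_{\mathbb{B}})^\natural\circ\widehat{\mathcal{P}}\zeta=\zeta\circ(\mathsf{Y}_{\mathbb{A}})^\natural$.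 *)

theory Defs
  imports "HOL-Algebra.Complete_Lattice"
begin

text \<open>
  A small quantaloid.  Hom-sets at different pairs of objects need not be disjoint, so composition
  is indexed by its three objects: \<open>qcomp Q X Y Z g f\<close> is $g \circ f$ for $f\colon X\to Y$ and
  $g\colon Y\to Z$.
\<close>

record ('o, 'q) quantaloid =
  objs :: "'o set"
  homs :: "'o \<Rightarrow> 'o \<Rightarrow> 'q gorder"
  ident :: "'o \<Rightarrow> 'q"
  qcomp :: "'o \<Rightarrow> 'o \<Rightarrow> 'o \<Rightarrow> 'q \<Rightarrow> 'q \<Rightarrow> 'q"

locale quantaloid =
  fixes Q :: "('o, 'q) quantaloid"
  assumes homs_complete_lattice:
      "\<lbrakk>X \<in> objs Q; Y \<in> objs Q\<rbrakk> \<Longrightarrow> complete_lattice (homs Q X Y)"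
    and ident_closed:
      "X \<in> objs Q \<Longrightarrow> ident Q X \<in> carrier (homs Q X X)"
    and comp_closed:
      "\<lbrakk>X \<in> objs Q; Y \<in> objs Q; Z \<in> objs Q;
        f \<in> carrier (homs Q X Y); g \<in> carrier (homs Q Y Z)\<rbrakk>
       \<Longrightarrow> qcomp Q X Y Z g f \<in> carrier (homs Q X Z)"
    and comp_ident_left:
      "\<lbrakk>X \<in> objs Q; Y \<in> objs Q; f \<in> carrier (homs Q X Y)\<rbrakk>
       \<Longrightarrow> qcomp Q X Y Y (ident Q Y) f = f"
    and comp_ident_right:
      "\<lbrakk>X \<in> objs Q; Y \<in> objs Q; f \<in> carrier (homs Q X Y)\<rbrakk>
       \<Longrightarrow> qcomp Q X X Y f (ident Q X) = f"
    and comp_assoc: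
      "\<lbrakk>W \<in> objs Q; X \<in> objs Q; Y \<in> objs Q; Z \<in> objs Q;
        f \<in> carrier (homs Q W X); g \<in> carrier (homs Q X Y); h \<in> carrier (homs Q Y Z)\<rbrakk>
       \<Longrightarrow> qcomp Q W Y Z h (qcomp Q W X Y g f) = qcomp Q W X Z (qcomp Q X Y Z h g) f"
    and comp_Sup_left:
      "\<lbrakk>X \<in> objs Q; Y \<in> objs Q; Z \<in> objs Q;
        f \<in> carrier (homs Q X Y); S \<subseteq> carrier (homs Q Y Z)\<rbrakk>
       \<Longrightarrow> qcomp Q X Y Z (\<Squnion>\<^bsub>homs Q Y Z\<^esub> S) f = \<Squnion>\<^bsub>homs Q X Z\<^esub> ((\<lambda>g. qcomp Q X Y Z g f) ` S)"
    and comp_Sup_right: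
      "\<lbrakk>X \<in> objs Q; Y \<in> objs Q; Z \<in> objs Q;
        S \<subseteq> carrier (homs Q X Y); g \<in> carrier (homs Q Y Z)\<rbrakk>
       \<Longrightarrow> qcomp Q X Y Z g (\<Squnion>\<^bsub>homs Q X Y\<^esub> S) = \<Squnion>\<^bsub>homs Q X Z\<^esub> ((\<lambda>f. qcomp Q X Y Z g f) ` S)"

record ('o, 'q, 'a) qcat =
  ob :: "'a set"
  ty :: "'a \<Rightarrow> 'o"
  arr :: "'a \<Rightarrow> 'a \<Rightarrow> 'q"

locale q_category = quantaloid Q
  for Q :: "('o, 'q) quantaloid" +
  fixes A :: "('o, 'q, 'a) qcat"
  assumes ty_closed:
      "x \<in> ob A \<Longrightarrow> ty A x \<in> objs Q"
    and arr_closed: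
      "\<lbrakk>x \<in> ob A; y \<in> ob A\<rbrakk> \<Longrightarrow> arr A x y \<in> carrier (homs Q (ty A x) (ty A y))"
    and arr_refl:
      "x \<in> ob A \<Longrightarrow> ident Q (ty A x) \<sqsubseteq>\<^bsub>homs Q (ty A x) (ty A x)\<^esub> arr A x x"
    and arr_trans:
      "\<lbrakk>x \<in> ob A; y \<in> ob A; z \<in> ob A\<rbrakk>
       \<Longrightarrow> qcomp Q (ty A x) (ty A y) (ty A z) (arr A y z) (arr A x y)
            \<sqsubseteq>\<^bsub>homs Q (ty A x) (ty A z)\<^esub> arr A x z"

text \<open>
  Distributors are extensional functions on the product of the object sets, so that HOL equality
  of distributors is equality of families.
\<close>

definition dist ::
  "('o, 'q) quantaloid \<Rightarrow> ('o, 'q, 'a) qcat \<Rightarrow> ('o, 'q, 'b) qcat \<Rightarrow> ('a \<times> 'b \<Rightarrow> 'q) set" where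
  "dist Q A B =
    {\<phi> \<in> (\<Pi>\<^sub>E (x, y) \<in> ob A \<times> ob B. carrier (homs Q (ty A x) (ty B y))).
      (\<forall>x \<in> ob A. \<forall>y' \<in> ob B. \<forall>y \<in> ob B.
        qcomp Q (ty A x) (ty B y') (ty B y) (arr B y' y) (\<phi> (x, y'))
          \<sqsubseteq>\<^bsub>homs Q (ty A x) (ty B y)\<^esub> \<phi> (x, y)) \<and>
      (\<forall>x \<in> ob A. \<forall>x' \<in> ob A. \<forall>y \<in> ob B.
        qcomp Q (ty A x) (ty A x') (ty B y) (\<phi> (x', y)) (arr A x x')
          \<sqsubseteq>\<^bsub>homs Q (ty A x) (ty B y)\<^esub> \<phi> (x, y))}"

definition dist_le ::
  "('o, 'q) quantaloid \<Rightarrow> ('o, 'q, 'a) qcat \<Rightarrow> ('o, 'q, 'b) qcat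
    \<Rightarrow> ('a \<times> 'b \<Rightarrow> 'q) \<Rightarrow> ('a \<times> 'b \<Rightarrow> 'q) \<Rightarrow> bool" where
  "dist_le Q A B \<phi> \<psi> \<longleftrightarrow>
    (\<forall>x \<in> ob A. \<forall>y \<in> ob B. \<phi> (x, y) \<sqsubseteq>\<^bsub>homs Q (ty A x) (ty B y)\<^esub> \<psi> (x, y))"

definition dist_comp ::
  "('o, 'q) quantaloid \<Rightarrow> ('o, 'q, 'a) qcat \<Rightarrow> ('o, 'q, 'b) qcat \<Rightarrow> ('o, 'q, 'c) qcat
    \<Rightarrow> ('b \<times> 'c \<Rightarrow> 'q) \<Rightarrow> ('a \<times> 'b \<Rightarrow> 'q) \<Rightarrow> ('a \<times> 'c \<Rightarrow> 'q)" where
  "dist_comp Q A B C \<psi> \<phi> =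
    (\<lambda>(x, z) \<in> ob A \<times> ob C.
      \<Squnion>\<^bsub>homs Q (ty A x) (ty C z)\<^esub>
        ((\<lambda>y. qcomp Q (ty A x) (ty B y) (ty C z) (\<psi> (y, z)) (\<phi> (x, y))) ` ob B))"

definition dist_id :: "('o, 'q, 'a) qcat \<Rightarrow> ('a \<times> 'a \<Rightarrow> 'q)" where
  "dist_id A = (\<lambda>(x, y) \<in> ob A \<times> ob A. arr A x y)"

text \<open>
  \<open>dist_adj Q A B \<phi> \<psi>\<close> says $\phi \dashv \psi$ for $\phi\colon A\to B$ and $\psi\colon B\to A$.
\<close>

definition dist_adj ::
  "('o, 'q) quantaloid \<Rightarrow> ('o, 'q, 'a) qcat \<Rightarrow> ('o, 'q, 'b) qcat
    \<Rightarrow> ('a \<times> 'b \<Rightarrow> 'q) \<Rightarrow> ('b \<times> 'a \<Rightarrow> 'q) \<Rightarrow> bool" where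
  "dist_adj Q A B \<phi> \<psi> \<longleftrightarrow>
    \<phi> \<in> dist Q A B \<and> \<psi> \<in> dist Q B A \<and>
    dist_le Q A A (dist_id A) (dist_comp Q A B A \<psi> \<phi>) \<and>
    dist_le Q B B (dist_comp Q B A B \<phi> \<psi>) (dist_id B)"

definition left_adjoint_dist ::
  "('o, 'q) quantaloid \<Rightarrow> ('o, 'q, 'a) qcat \<Rightarrow> ('o, 'q, 'b) qcat \<Rightarrow> ('a \<times> 'b \<Rightarrow> 'q) \<Rightarrow> bool" where
  "left_adjoint_dist Q A B \<zeta> \<longleftrightarrow> (\<exists>\<xi>. dist_adj Q A B \<zeta> \<xi>)"

definition right_adjoint_dist ::
  "('o, 'q) quantaloid \<Rightarrow> ('o, 'q, 'a) qcat \<Rightarrow> ('o, 'q, 'b) qcat \<Rightarrow> ('a \<times> 'b \<Rightarrow> 'q) \<Rightarrow> bool" where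
  "right_adjoint_dist Q A B \<zeta> \<longleftrightarrow> (\<exists>\<xi>. dist_adj Q B A \<xi> \<zeta>)"

text \<open>The unique right adjoint $\zeta^*$ of a left adjoint $\zeta\colon A\to B$.\<close>

definition right_adj ::
  "('o, 'q) quantaloid \<Rightarrow> ('o, 'q, 'a) qcat \<Rightarrow> ('o, 'q, 'b) qcat
    \<Rightarrow> ('a \<times> 'b \<Rightarrow> 'q) \<Rightarrow> ('b \<times> 'a \<Rightarrow> 'q)" where
  "right_adj Q A B \<zeta> = (THE \<xi>. dist_adj Q A B \<zeta> \<xi>)"

text \<open>
  The implication $\theta \swarrow \phi\colon B\to C$ of $\phi\colon A\to B$ and
  $\theta\colon A\to C$, specified by its universal property.
\<close>

definition dist_limp ::
  "('o, 'q) quantaloid \<Rightarrow> ('o, 'q, 'a) qcat \<Rightarrow> ('o, 'q, 'b) qcat \<Rightarrow> ('o, 'q, 'c) qcat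
    \<Rightarrow> ('a \<times> 'c \<Rightarrow> 'q) \<Rightarrow> ('a \<times> 'b \<Rightarrow> 'q) \<Rightarrow> ('b \<times> 'c \<Rightarrow> 'q)" where
  "dist_limp Q A B C \<theta> \<phi> =
    (THE \<kappa>. \<kappa> \<in> dist Q B C \<and>
      (\<forall>\<psi> \<in> dist Q B C.
        dist_le Q A C (dist_comp Q A B C \<psi> \<phi>) \<theta> \<longleftrightarrow> dist_le Q B C \<psi> \<kappa>))"

definition graph ::
  "('o, 'q, 'a) qcat \<Rightarrow> ('o, 'q, 'b) qcat \<Rightarrow> ('a \<Rightarrow> 'b) \<Rightarrow> ('a \<times> 'b \<Rightarrow> 'q)" where
  "graph A B F = (\<lambda>(x, y) \<in> ob A \<times> ob B. arr B (F x) y)"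

definition cograph ::
  "('o, 'q, 'a) qcat \<Rightarrow> ('o, 'q, 'b) qcat \<Rightarrow> ('a \<Rightarrow> 'b) \<Rightarrow> ('b \<times> 'a \<Rightarrow> 'q)" where
  "cograph A B F = (\<lambda>(y, x) \<in> ob B \<times> ob A. arr B y (F x))"

definition star :: "('o, 'q) quantaloid \<Rightarrow> 'o \<Rightarrow> ('o, 'q, unit) qcat" where
  "star Q X = \<lparr>ob = {()}, ty = (\<lambda>_. X), arr = (\<lambda>_ _. ident Q X)\<rparr>"

text \<open>
  An object of the presheaf category is a pair of its type $X$ and a distributor $A\to *_X$.
  A hom-arrow is the unique component of the distributor $\mu' \swarrow \mu\colon *_X \to *_Y$.
\<close>

type_synonym ('o, 'q, 'a) presheaf = "'o \<times> ('a \<times> unit \<Rightarrow> 'q)"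

definition psh ::
  "('o, 'q) quantaloid \<Rightarrow> ('o, 'q, 'a) qcat \<Rightarrow> ('o, 'q, ('o, 'q, 'a) presheaf) qcat" where
  "psh Q A =
    \<lparr>ob = (SIGMA X : objs Q. dist Q A (star Q X)),
     ty = fst,
     arr = (\<lambda>(X, \<mu>) (Y, \<mu>'). dist_limp Q A (star Q X) (star Q Y) \<mu>' \<mu> ((), ()))\<rparr>"

definition yoneda :: "('o, 'q, 'a) qcat \<Rightarrow> 'a \<Rightarrow> ('o, 'q, 'a) presheaf" where
  "yoneda A a = (ty A a, \<lambda>(x, _) \<in> ob A \<times> {()}. arr A x a)"

definition psh_push ::
  "('o, 'q) quantaloid \<Rightarrow> ('o, 'q, 'a) qcat \<Rightarrow> ('o, 'q, 'b) qcat \<Rightarrow> ('a \<times> 'b \<Rightarrow> 'q)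
    \<Rightarrow> ('o, 'q, 'a) presheaf \<Rightarrow> ('o, 'q, 'b) presheaf" where
  "psh_push Q A B \<zeta> = (\<lambda>(X, \<mu>). (X, dist_comp Q B A (star Q X) \<mu> (right_adj Q A B \<zeta>)))"

text \<open>The action $\widehat{\mathcal P}\zeta$ of the presheaf monad on a left adjoint $\zeta$.\<close>

definition psh_map ::
  "('o, 'q) quantaloid \<Rightarrow> ('o, 'q, 'a) qcat \<Rightarrow> ('o, 'q, 'b) qcat \<Rightarrow> ('a \<times> 'b \<Rightarrow> 'q)
    \<Rightarrow> (('o, 'q, 'a) presheaf \<times> ('o, 'q, 'b) presheaf \<Rightarrow> 'q)" where
  "psh_map Q A B \<zeta> = graph (psh Q A) (psh Q B) (psh_push Q A B \<zeta>)"

definition psh_algebra ::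
  "('o, 'q) quantaloid \<Rightarrow> ('o, 'q, 'a) qcat \<Rightarrow> (('o, 'q, 'a) presheaf \<times> 'a \<Rightarrow> 'q) \<Rightarrow> bool" where
  "psh_algebra Q A \<phi> \<longleftrightarrow>
    q_category Q A \<and>
    left_adjoint_dist Q (psh Q A) A \<phi> \<and>
    dist_adj Q A (psh Q A) (graph A (psh Q A) (yoneda A)) \<phi>"

definition psh_algebra_hom ::
  "('o, 'q) quantaloid \<Rightarrow> ('o, 'q, 'a) qcat \<Rightarrow> ('o, 'q, 'b) qcat \<Rightarrow> ('a \<times> 'b \<Rightarrow> 'q) \<Rightarrow> bool" where
  "psh_algebra_hom Q A B \<zeta> \<longleftrightarrow>
    left_adjoint_dist Q A B \<zeta> \<and>
    dist_comp Q (psh Q A) (psh Q B) B (cograph B (psh Q B) (yoneda B)) (psh_map Q A B \<zeta>) =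
    dist_comp Q (psh Q A) A B \<zeta> (cograph A (psh Q A) (yoneda A))"

end

theory Submission imports Defs begin

text \<open>
  The proof compares the two sides of the homomorphism equation value by value.  For presheaves
  \<open>\<mu>\<close> and \<open>\<nu>\<close> on the same category, \<open>\<nu> \<swarrow> \<mu>\<close> is the largest arrow \<open>k\<close> with \<open>k \<circ> \<mu> \<le> \<nu>\<close>.

  At a presheaf \<open>\<mu>\<close> on \<open>A\<close> and an object \<open>b\<close> of \<open>B\<close>, the side that pushes \<open>\<mu>\<close> forward to \<open>B\<close> first has the value
  \<open>B(-,b) \<swarrow> (\<mu> \<circ> \<zeta>\<^sup>*)\<close>.  Since \<open>\<zeta> \<stileturn> \<zeta>\<^sup>*\<close>, the condition \<open>k \<circ> \<mu> \<circ> \<zeta>\<^sup>* \<le> B(-,b)\<close> means the same as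
  \<open>k \<circ> \<mu> \<le> \<zeta>(-,b)\<close>, so this value is \<open>\<zeta>(-,b) \<swarrow> \<mu>\<close> (\<open>le_hom_psh_push_yoneda_iff\<close>).  The other
  side has the value \<open>\<Squnion>\<^sub>a \<zeta>(a,b) \<circ> (A(-,a) \<swarrow> \<mu>)\<close>, which is always below.  Hence \<open>\<zeta>\<close> is a
  homomorphism iff composing with \<open>\<zeta>\<close> commutes with all implications out of presheaves, in
  symbols \<open>\<zeta> \<swarrow> \<mu> \<le> \<zeta> \<circ> (A \<swarrow> \<mu>)\<close> (\<open>psh_algebra_hom_iff\<close>).

  A right adjoint \<open>\<zeta>\<close> has this property: if \<open>\<chi> \<stileturn> \<zeta>\<close> and \<open>k \<circ> \<mu> \<le> \<zeta>(-,b)\<close>, then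
  \<open>\<chi> \<circ> k \<circ> \<mu> \<le> A\<close>, so \<open>\<chi> \<circ> k \<le> A \<swarrow> \<mu>\<close> and \<open>k \<le> \<zeta> \<circ> \<chi> \<circ> k \<le> \<zeta> \<circ> (A \<swarrow> \<mu>)\<close>
  (\<open>psh_algebra_hom_if_right_adjoint\<close>).

  Conversely, the only possible left adjoint of \<open>\<zeta>\<close> is \<open>\<chi> = A \<swarrow> \<zeta>\<close>, and \<open>\<chi> \<circ> \<zeta> \<le> A\<close> holds by
  definition.  Applying the property to the presheaf \<open>\<mu> = \<zeta>(-,b)\<close> itself turns the trivial
  inequality \<open>1 \<le> \<zeta>(-,b) \<swarrow> \<zeta>(-,b)\<close> into \<open>1 \<le> \<Squnion>\<^sub>a \<zeta>(a,b) \<circ> \<chi>(b,a)\<close>, which is the other adjunction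
  inequality (\<open>right_adjoint_if_psh_algebra_hom\<close>).
\<close>

section \<open>Arrows of a quantaloid\<close>

context quantaloid
begin

definition arrow :: "'o \<Rightarrow> 'o \<Rightarrow> 'q \<Rightarrow> bool" where
  "arrow X Y f \<longleftrightarrow> X \<in> objs Q \<and> Y \<in> objs Q \<and> f \<in> carrier (homs Q X Y)"

text \<open>
  The order of a hom-lattice together with the typing of both sides, so that transitivity and
  monotonicity of composition hold without side conditions.
\<close>

definition arrow_le :: "'o \<Rightarrow> 'o \<Rightarrow> 'q \<Rightarrow> 'q \<Rightarrow> bool" where
  "arrow_le X Y f g \<longleftrightarrow> arrow X Y f \<and> arrow X Y g \<and> f \<sqsubseteq>\<^bsub>homs Q X Y\<^esub> g"

lemma arrow_leD: "arrow_le X Y f g \<Longrightarrow> arrow X Y f" "arrow_le X Y f g \<Longrightarrow> arrow X Y g"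
  by (auto simp: arrow_le_def)

lemma arrow_ident: "X \<in> objs Q \<Longrightarrow> arrow X X (ident Q X)"
  by (simp add: arrow_def ident_closed)

lemma arrow_comp: "arrow X Y f \<Longrightarrow> arrow Y Z g \<Longrightarrow> arrow X Z (qcomp Q X Y Z g f)"
  by (auto simp: arrow_def comp_closed)

lemma arrow_comp_assoc:
  "arrow W X f \<Longrightarrow> arrow X Y g \<Longrightarrow> arrow Y Z h \<Longrightarrow>
   qcomp Q W Y Z h (qcomp Q W X Y g f) = qcomp Q W X Z (qcomp Q X Y Z h g) f"
  by (auto simp: arrow_def comp_assoc)

lemma arrow_comp_ident:
  assumes "arrow X Y f"
  shows "qcomp Q X Y Y (ident Q Y) f = f" "qcomp Q X X Y f (ident Q X) = f"
  using assms by (auto simp: arrow_def comp_ident_left comp_ident_right)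

lemma hom_partial_order: "arrow X Y f \<Longrightarrow> partial_order (homs Q X Y)"
  using homs_complete_lattice[of X Y]
  by (auto simp: arrow_def complete_lattice_def lattice_def upper_semilattice_def)

lemma arrow_le_refl: "arrow X Y f \<Longrightarrow> arrow_le X Y f f"
  using hom_partial_order[of X Y f]
  by (auto simp: arrow_le_def arrow_def partial_order_def intro: weak_partial_order.le_refl)

lemma arrow_le_trans [trans]: "arrow_le X Y f g \<Longrightarrow> arrow_le X Y g h \<Longrightarrow> arrow_le X Y f h"
  using hom_partial_order[of X Y f]
  by (auto simp: arrow_le_def arrow_def partial_order_def intro: weak_partial_order.le_trans)

lemma arrow_le_antisym: "arrow_le X Y f g \<Longrightarrow> arrow_le X Y g f \<Longrightarrow> f = g"
  using hom_partial_order[of X Y f]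
  by (auto simp: arrow_le_def arrow_def intro: partial_order.le_antisym)

lemma arrow_join:
  assumes "X \<in> objs Q" "Y \<in> objs Q" "\<And>f. f \<in> S \<Longrightarrow> arrow X Y f"
  shows "arrow X Y (\<Squnion>\<^bsub>homs Q X Y\<^esub> S)"
proof -
  interpret complete_lattice "homs Q X Y" by (rule homs_complete_lattice) fact+
  show ?thesis using assms by (auto simp: arrow_def intro: sup_closed)
qed

lemma arrow_le_join:
  assumes "\<And>f. f \<in> S \<Longrightarrow> arrow X Y f" "f \<in> S"
  shows "arrow_le X Y f (\<Squnion>\<^bsub>homs Q X Y\<^esub> S)"
proof -
  have XY: "X \<in> objs Q" "Y \<in> objs Q" using assms by (auto simp: arrow_def)
  interpret complete_lattice "homs Q X Y" by (rule homs_complete_lattice) fact+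
  have "S \<subseteq> carrier (homs Q X Y)" using assms by (auto simp: arrow_def)
  then show ?thesis
    using assms XY by (auto simp: arrow_le_def intro: sup_upper arrow_join)
qed

lemma join_arrow_le:
  assumes "arrow X Y t" "\<And>f. f \<in> S \<Longrightarrow> arrow_le X Y f t"
  shows "arrow_le X Y (\<Squnion>\<^bsub>homs Q X Y\<^esub> S) t"
proof -
  have XY: "X \<in> objs Q" "Y \<in> objs Q" using assms by (auto simp: arrow_def)
  interpret complete_lattice "homs Q X Y" by (rule homs_complete_lattice) fact+
  have "S \<subseteq> carrier (homs Q X Y)" using assms by (auto simp: arrow_le_def arrow_def)
  moreover have "arrow X Y (\<Squnion>\<^bsub>homs Q X Y\<^esub> S)"
    using XY assms(2) by (auto simp: arrow_le_def intro: arrow_join)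
  ultimately show ?thesis
    using assms by (auto simp: arrow_le_def arrow_def intro!: sup_least simp: Upper_def)
qed

lemma comp_join_le:
  assumes "arrow Y Z g" "arrow X Z t" "X \<in> objs Q" "\<And>f. f \<in> S \<Longrightarrow> arrow X Y f"
    and "\<And>f. f \<in> S \<Longrightarrow> arrow_le X Z (qcomp Q X Y Z g f) t"
  shows "arrow_le X Z (qcomp Q X Y Z g (\<Squnion>\<^bsub>homs Q X Y\<^esub> S)) t"
proof -
  have "qcomp Q X Y Z g (\<Squnion>\<^bsub>homs Q X Y\<^esub> S) = \<Squnion>\<^bsub>homs Q X Z\<^esub> ((\<lambda>f. qcomp Q X Y Z g f) ` S)"
    using assms(1,3,4) by (intro comp_Sup_right) (auto simp: arrow_def)
  then show ?thesis using assms by (auto intro!: join_arrow_le)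
qed

lemma join_comp_le:
  assumes "arrow X Y f" "arrow X Z t" "\<And>g. g \<in> S \<Longrightarrow> arrow Y Z g"
    and "\<And>g. g \<in> S \<Longrightarrow> arrow_le X Z (qcomp Q X Y Z g f) t"
  shows "arrow_le X Z (qcomp Q X Y Z (\<Squnion>\<^bsub>homs Q Y Z\<^esub> S) f) t"
proof -
  have "qcomp Q X Y Z (\<Squnion>\<^bsub>homs Q Y Z\<^esub> S) f = \<Squnion>\<^bsub>homs Q X Z\<^esub> ((\<lambda>g. qcomp Q X Y Z g f) ` S)"
    using assms(1-3) by (intro comp_Sup_left) (auto simp: arrow_def)
  then show ?thesis using assms by (auto intro!: join_arrow_le)
qed

text \<open>
  Monotonicity is a case of preservation of joins, as \<open>f \<le> f'\<close> means that \<open>f'\<close> is the join of \<open>{f, f'}\<close>.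
\<close>

lemma arrow_comp_mono:
  assumes f: "arrow_le X Y f f'" and g: "arrow_le Y Z g g'"
  shows "arrow_le X Z (qcomp Q X Y Z g f) (qcomp Q X Y Z g' f')"
proof -
  have join: "\<Squnion>\<^bsub>homs Q V W\<^esub> {h, h'} = h'" if "arrow_le V W h h'" for V W h h'
    using that
    by (intro arrow_le_antisym[where X = V and Y = W] join_arrow_le arrow_le_join)
      (auto dest: arrow_leD intro: arrow_le_refl)
  have [simp]: "X \<in> objs Q" "Y \<in> objs Q" "Z \<in> objs Q"
    using f g by (auto simp: arrow_le_def arrow_def)
  have "qcomp Q X Y Z g' f = \<Squnion>\<^bsub>homs Q X Z\<^esub> ((\<lambda>g. qcomp Q X Y Z g f) ` {g, g'})"
    using f g by (subst comp_Sup_left[symmetric]) (auto simp: join arrow_le_def arrow_def)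
  moreover have "qcomp Q X Y Z g' f' = \<Squnion>\<^bsub>homs Q X Z\<^esub> ((\<lambda>f. qcomp Q X Y Z g' f) ` {f, f'})"
    using f g by (subst comp_Sup_right[symmetric]) (auto simp: join arrow_le_def arrow_def)
  moreover have "arrow_le X Z (qcomp Q X Y Z g f) (\<Squnion>\<^bsub>homs Q X Z\<^esub> ((\<lambda>g. qcomp Q X Y Z g f) ` {g, g'}))"
    using f g by (intro arrow_le_join) (auto dest: arrow_leD intro: arrow_comp)
  moreover have "arrow_le X Z (qcomp Q X Y Z g' f) (\<Squnion>\<^bsub>homs Q X Z\<^esub> ((\<lambda>f. qcomp Q X Y Z g' f) ` {f, f'}))"
    using f g by (intro arrow_le_join) (auto dest: arrow_leD intro: arrow_comp)
  ultimately show ?thesis by (metis arrow_le_trans)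
qed

text \<open>
  Enlarging one factor of a composite reduces an inequality to one about the larger composite;
  this rule and the next are the main backward steps below.
\<close>

lemma arrow_le_comp_trans:
  assumes "arrow_le X Y f f'" "arrow Y Z g" "arrow_le X Z (qcomp Q X Y Z g f') t"
  shows "arrow_le X Z (qcomp Q X Y Z g f) t"
  using assms arrow_comp_mono arrow_le_refl arrow_le_trans by blast

lemma arrow_le_comp_trans':
  assumes "arrow_le Y Z g g'" "arrow X Y f" "arrow_le X Z (qcomp Q X Y Z g' f) t"
  shows "arrow_le X Z (qcomp Q X Y Z g f) t"
  using assms arrow_comp_mono arrow_le_refl arrow_le_trans by blast

section \<open>Categories and distributors over a quantaloid\<close>

lemma hom_arrow: "q_category Q A \<Longrightarrow> x \<in> ob A \<Longrightarrow> y \<in> ob A \<Longrightarrow> arrow (ty A x) (ty A y) (arr A x y)"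
  by (auto simp: arrow_def q_category.arr_closed q_category.ty_closed)

lemma hom_refl: "q_category Q A \<Longrightarrow> x \<in> ob A \<Longrightarrow> arrow_le (ty A x) (ty A x) (ident Q (ty A x)) (arr A x x)"
  by (auto simp: arrow_le_def hom_arrow arrow_ident q_category.ty_closed q_category.arr_refl)

lemma hom_trans:
  "q_category Q A \<Longrightarrow> x \<in> ob A \<Longrightarrow> y \<in> ob A \<Longrightarrow> z \<in> ob A \<Longrightarrow>
   arrow_le (ty A x) (ty A z) (qcomp Q (ty A x) (ty A y) (ty A z) (arr A y z) (arr A x y)) (arr A x z)"
  by (auto simp: arrow_le_def q_category.arr_trans intro: hom_arrow arrow_comp)

lemma q_categoryI:
  assumes "\<And>x. x \<in> ob A \<Longrightarrow> ty A x \<in> objs Q"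
    and "\<And>x y. x \<in> ob A \<Longrightarrow> y \<in> ob A \<Longrightarrow> arrow (ty A x) (ty A y) (arr A x y)"
    and "\<And>x. x \<in> ob A \<Longrightarrow> arrow_le (ty A x) (ty A x) (ident Q (ty A x)) (arr A x x)"
    and "\<And>x y z. x \<in> ob A \<Longrightarrow> y \<in> ob A \<Longrightarrow> z \<in> ob A \<Longrightarrow>
      arrow_le (ty A x) (ty A z) (qcomp Q (ty A x) (ty A y) (ty A z) (arr A y z) (arr A x y)) (arr A x z)"
  shows "q_category Q A"
  using assms by unfold_locales (auto simp: arrow_def arrow_le_def)

definition distributor :: "('o, 'q, 'c) qcat \<Rightarrow> ('o, 'q, 'd) qcat \<Rightarrow> ('c \<times> 'd \<Rightarrow> 'q) \<Rightarrow> bool" where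
  "distributor A B \<phi> \<longleftrightarrow> q_category Q A \<and> q_category Q B \<and> \<phi> \<in> dist Q A B"

lemma distributor_arrow:
  "distributor A B \<phi> \<Longrightarrow> x \<in> ob A \<Longrightarrow> y \<in> ob B \<Longrightarrow> arrow (ty A x) (ty B y) (\<phi> (x, y))"
  by (auto simp: distributor_def dist_def arrow_def q_category.ty_closed dest!: PiE_mem[of _ _ _ "(x,y)"])

lemma distributor_left:
  assumes "distributor A B \<phi>" "x \<in> ob A" "y' \<in> ob B" "y \<in> ob B"
  shows "arrow_le (ty A x) (ty B y)
    (qcomp Q (ty A x) (ty B y') (ty B y) (arr B y' y) (\<phi> (x, y'))) (\<phi> (x, y))"
proof -
  have "arrow (ty A x) (ty B y) (qcomp Q (ty A x) (ty B y') (ty B y) (arr B y' y) (\<phi> (x, y')))"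
    using assms by (auto intro!: arrow_comp distributor_arrow hom_arrow simp: distributor_def)
  then show ?thesis
    using assms distributor_arrow[OF assms(1,2,4)]
    by (auto simp: arrow_le_def distributor_def dist_def)
qed

lemma distributor_right:
  assumes "distributor A B \<phi>" "x \<in> ob A" "x' \<in> ob A" "y \<in> ob B"
  shows "arrow_le (ty A x) (ty B y)
    (qcomp Q (ty A x) (ty A x') (ty B y) (\<phi> (x', y)) (arr A x x')) (\<phi> (x, y))"
proof -
  have "arrow (ty A x) (ty B y) (qcomp Q (ty A x) (ty A x') (ty B y) (\<phi> (x', y)) (arr A x x'))"
    using assms by (auto intro!: arrow_comp distributor_arrow hom_arrow simp: distributor_def)
  then show ?thesis
    using assms distributor_arrow[OF assms(1,2,4)]
    by (auto simp: arrow_le_def distributor_def dist_def)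
qed

lemma distributorI:
  assumes "q_category Q A" "q_category Q B" "\<phi> \<in> extensional (ob A \<times> ob B)"
    and "\<And>x y. x \<in> ob A \<Longrightarrow> y \<in> ob B \<Longrightarrow> arrow (ty A x) (ty B y) (\<phi> (x, y))"
    and "\<And>x y' y. x \<in> ob A \<Longrightarrow> y' \<in> ob B \<Longrightarrow> y \<in> ob B \<Longrightarrow> arrow_le (ty A x) (ty B y)
      (qcomp Q (ty A x) (ty B y') (ty B y) (arr B y' y) (\<phi> (x, y'))) (\<phi> (x, y))"
    and "\<And>x x' y. x \<in> ob A \<Longrightarrow> x' \<in> ob A \<Longrightarrow> y \<in> ob B \<Longrightarrow> arrow_le (ty A x) (ty B y)
      (qcomp Q (ty A x) (ty A x') (ty B y) (\<phi> (x', y)) (arr A x x')) (\<phi> (x, y))"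
  shows "distributor A B \<phi>"
  using assms by (auto simp: distributor_def dist_def arrow_def arrow_le_def PiE_def)

lemma distributor_le_iff:
  assumes "distributor A B \<phi>" "distributor A B \<psi>"
  shows "dist_le Q A B \<phi> \<psi> \<longleftrightarrow>
    (\<forall>x \<in> ob A. \<forall>y \<in> ob B. arrow_le (ty A x) (ty B y) (\<phi> (x, y)) (\<psi> (x, y)))"
  using assms by (auto simp: dist_le_def arrow_le_def intro: distributor_arrow)

lemma distributor_antisym:
  assumes "distributor A B \<phi>" "distributor A B \<psi>" "dist_le Q A B \<phi> \<psi>" "dist_le Q A B \<psi> \<phi>"
  shows "\<phi> = \<psi>"
proof (rule extensionalityI)
  show "\<phi> \<in> extensional (ob A \<times> ob B)" "\<psi> \<in> extensional (ob A \<times> ob B)"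
    using assms by (auto simp: distributor_def dist_def PiE_def)
  show "\<phi> p = \<psi> p" if "p \<in> ob A \<times> ob B" for p
  proof -
    obtain x y where p: "p = (x, y)" "x \<in> ob A" "y \<in> ob B" using \<open>p \<in> _\<close> by blast
    then show ?thesis
      using assms arrow_le_antisym[of "ty A x" "ty B y"] by (simp add: distributor_le_iff)
  qed
qed

lemma distributor_id: "q_category Q A \<Longrightarrow> distributor A A (dist_id A)"
  by (rule distributorI) (auto simp: dist_id_def intro: hom_arrow hom_trans)

context
  fixes A :: "('o, 'q, 'c) qcat" and B :: "('o, 'q, 'd) qcat" and C :: "('o, 'q, 'e) qcat"
    and \<phi> \<psi>
  assumes \<phi>: "distributor A B \<phi>" and \<psi>: "distributor B C \<psi>"
begin

private lemma comp_arrow: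
  "x \<in> ob A \<Longrightarrow> y \<in> ob B \<Longrightarrow> z \<in> ob C \<Longrightarrow>
    arrow (ty A x) (ty C z) (qcomp Q (ty A x) (ty B y) (ty C z) (\<psi> (y, z)) (\<phi> (x, y)))"
  using \<phi> \<psi> by (intro arrow_comp distributor_arrow)

private lemma comp_ty: "x \<in> ob A \<Longrightarrow> ty A x \<in> objs Q" "z \<in> ob C \<Longrightarrow> ty C z \<in> objs Q"
  using \<phi> \<psi> by (auto simp: distributor_def q_category.ty_closed)

lemma dist_comp_arrow:
  "x \<in> ob A \<Longrightarrow> z \<in> ob C \<Longrightarrow> arrow (ty A x) (ty C z) (dist_comp Q A B C \<psi> \<phi> (x, z))"
  by (auto simp: dist_comp_def comp_ty intro!: arrow_join comp_arrow)

lemma le_dist_comp: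
  "x \<in> ob A \<Longrightarrow> y \<in> ob B \<Longrightarrow> z \<in> ob C \<Longrightarrow> arrow_le (ty A x) (ty C z)
    (qcomp Q (ty A x) (ty B y) (ty C z) (\<psi> (y, z)) (\<phi> (x, y))) (dist_comp Q A B C \<psi> \<phi> (x, z))"
  by (auto simp: dist_comp_def comp_ty intro!: arrow_le_join comp_arrow)

lemma dist_comp_le:
  "x \<in> ob A \<Longrightarrow> z \<in> ob C \<Longrightarrow> arrow (ty A x) (ty C z) t \<Longrightarrow>
   (\<And>y. y \<in> ob B \<Longrightarrow> arrow_le (ty A x) (ty C z) (qcomp Q (ty A x) (ty B y) (ty C z) (\<psi> (y, z)) (\<phi> (x, y))) t)
   \<Longrightarrow> arrow_le (ty A x) (ty C z) (dist_comp Q A B C \<psi> \<phi> (x, z)) t"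
  by (auto simp: dist_comp_def intro!: join_arrow_le)

lemma comp_dist_comp_le:
  "x \<in> ob A \<Longrightarrow> z \<in> ob C \<Longrightarrow> arrow (ty C z) W g \<Longrightarrow> arrow (ty A x) W t \<Longrightarrow>
   (\<And>y. y \<in> ob B \<Longrightarrow> arrow_le (ty A x) W
     (qcomp Q (ty A x) (ty B y) W (qcomp Q (ty B y) (ty C z) W g (\<psi> (y, z))) (\<phi> (x, y))) t)
   \<Longrightarrow> arrow_le (ty A x) W (qcomp Q (ty A x) (ty C z) W g (dist_comp Q A B C \<psi> \<phi> (x, z))) t"
  using \<phi> \<psi>
  by (auto simp: dist_comp_def arrow_comp_assoc distributor_arrow comp_ty intro!: comp_join_le comp_arrow)

lemma dist_comp_comp_le:
  "x \<in> ob A \<Longrightarrow> z \<in> ob C \<Longrightarrow> arrow W (ty A x) f \<Longrightarrow> arrow W (ty C z) t \<Longrightarrow>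
   (\<And>y. y \<in> ob B \<Longrightarrow> arrow_le W (ty C z)
     (qcomp Q W (ty B y) (ty C z) (\<psi> (y, z)) (qcomp Q W (ty A x) (ty B y) (\<phi> (x, y)) f)) t)
   \<Longrightarrow> arrow_le W (ty C z) (qcomp Q W (ty A x) (ty C z) (dist_comp Q A B C \<psi> \<phi> (x, z)) f) t"
  using \<phi> \<psi>
  by (auto simp: dist_comp_def arrow_comp_assoc[symmetric] distributor_arrow comp_ty
      intro!: join_comp_le comp_arrow)

lemma distributor_comp: "distributor A C (dist_comp Q A B C \<psi> \<phi>)"
proof (rule distributorI)
  show A: "q_category Q A" and C: "q_category Q C" using \<phi> \<psi> by (auto simp: distributor_def)
  show "dist_comp Q A B C \<psi> \<phi> \<in> extensional (ob A \<times> ob C)" by (simp add: dist_comp_def)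
  show "arrow (ty A x) (ty C z) (dist_comp Q A B C \<psi> \<phi> (x, z))"
    if "x \<in> ob A" "z \<in> ob C" for x z by (rule dist_comp_arrow) fact+
  show "arrow_le (ty A x) (ty C z)
      (qcomp Q (ty A x) (ty C z') (ty C z) (arr C z' z) (dist_comp Q A B C \<psi> \<phi> (x, z')))
      (dist_comp Q A B C \<psi> \<phi> (x, z))"
    if "x \<in> ob A" "z' \<in> ob C" "z \<in> ob C" for x z' z
    using that C \<phi> \<psi>
    by (intro comp_dist_comp_le)
      (auto intro: hom_arrow dist_comp_arrow arrow_le_comp_trans'[OF distributor_left]
        distributor_arrow le_dist_comp)
  show "arrow_le (ty A x) (ty C z)
      (qcomp Q (ty A x) (ty A x') (ty C z) (dist_comp Q A B C \<psi> \<phi> (x', z)) (arr A x x'))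
      (dist_comp Q A B C \<psi> \<phi> (x, z))"
    if "x \<in> ob A" "x' \<in> ob A" "z \<in> ob C" for x x' z
    using that A \<phi> \<psi>
    by (intro dist_comp_comp_le)
      (auto intro: hom_arrow dist_comp_arrow arrow_le_comp_trans[OF distributor_right]
        distributor_arrow le_dist_comp)
qed

end

context
  fixes A :: "('o, 'q, 'c) qcat" and B :: "('o, 'q, 'd) qcat" and \<zeta> \<xi>
  assumes A: "q_category Q A" and B: "q_category Q B" and adj: "dist_adj Q A B \<zeta> \<xi>"
begin

lemma adj_distributor: "distributor A B \<zeta>" "distributor B A \<xi>"
  using A B adj by (auto simp: distributor_def dist_adj_def)

lemma adj_counit:
  assumes "a \<in> ob A" "b \<in> ob B" "b' \<in> ob B"
  shows "arrow_le (ty B b) (ty B b')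
    (qcomp Q (ty B b) (ty A a) (ty B b') (\<zeta> (a, b')) (\<xi> (b, a))) (arr B b b')"
proof -
  note * = le_dist_comp[OF adj_distributor(2,1) assms(2,1,3)]
  have "dist_le Q B B (dist_comp Q B A B \<zeta> \<xi>) (dist_id B)"
    using adj by (simp add: dist_adj_def)
  then have "arrow_le (ty B b) (ty B b') (dist_comp Q B A B \<zeta> \<xi> (b, b')) (dist_id B (b, b'))"
    using assms distributor_le_iff[OF distributor_comp[OF adj_distributor(2,1)] distributor_id[OF B]]
    by blast
  with * show ?thesis
    using assms arrow_le_trans by (auto simp: dist_id_def)
qed

lemma adj_unit:
  assumes "a \<in> ob A"
  shows "arrow_le (ty A a) (ty A a) (ident Q (ty A a)) (dist_comp Q A B A \<xi> \<zeta> (a, a))"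
proof -
  have "dist_le Q A A (dist_id A) (dist_comp Q A B A \<xi> \<zeta>)"
    using adj by (simp add: dist_adj_def)
  then have "arrow_le (ty A a) (ty A a) (dist_id A (a, a)) (dist_comp Q A B A \<xi> \<zeta> (a, a))"
    using assms distributor_le_iff[OF distributor_id[OF A] distributor_comp[OF adj_distributor]]
    by blast
  with hom_refl[OF A assms] show ?thesis
    using assms arrow_le_trans by (auto simp: dist_id_def)
qed

text \<open>
  This is the unit inequality in the form in which it is applied: from
  \<open>f \<le> (\<xi> \<circ> \<zeta>)(a,a) \<circ> f\<close> and distributivity over joins, it suffices to bound
  \<open>\<xi>(b,a) \<circ> \<zeta>(a,b) \<circ> f\<close> for each \<open>b\<close>.  The next lemma is the same for composition on the other
  side.
\<close>

lemma adj_unit_le_into: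
  assumes "a \<in> ob A" "arrow W (ty A a) f" "arrow W (ty A a) t"
    and "\<And>b. b \<in> ob B \<Longrightarrow> arrow_le W (ty A a)
      (qcomp Q W (ty B b) (ty A a) (\<xi> (b, a)) (qcomp Q W (ty A a) (ty B b) (\<zeta> (a, b)) f)) t"
  shows "arrow_le W (ty A a) f t"
proof -
  have "arrow_le W (ty A a) (qcomp Q W (ty A a) (ty A a) (ident Q (ty A a)) f) t"
    using assms adj_distributor
    by (intro arrow_le_comp_trans'[OF adj_unit] dist_comp_comp_le) auto
  then show ?thesis using assms by (simp add: arrow_comp_ident)
qed

lemma adj_unit_le_out:
  assumes "a \<in> ob A" "arrow (ty A a) W g" "arrow (ty A a) W t"
    and "\<And>b. b \<in> ob B \<Longrightarrow> arrow_le (ty A a) W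
      (qcomp Q (ty A a) (ty B b) W (qcomp Q (ty B b) (ty A a) W g (\<xi> (b, a))) (\<zeta> (a, b))) t"
  shows "arrow_le (ty A a) W g t"
proof -
  have "arrow_le (ty A a) W (qcomp Q (ty A a) (ty A a) W g (ident Q (ty A a))) t"
    using assms adj_distributor
    by (intro arrow_le_comp_trans[OF adj_unit] comp_dist_comp_le) auto
  then show ?thesis using assms by (simp add: arrow_comp_ident)
qed

end

text \<open>
  The usual argument for uniqueness of adjoints: \<open>\<xi> \<le> \<xi>' \<circ> \<zeta> \<circ> \<xi> \<le> \<xi>'\<close>.
\<close>

lemma right_adjoint_le:
  assumes A: "q_category Q A" and B: "q_category Q B"
    and \<xi>: "dist_adj Q A B \<zeta> \<xi>" and \<xi>': "dist_adj Q A B \<zeta> \<xi>'"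
  shows "dist_le Q B A \<xi> \<xi>'"
proof -
  note d = adj_distributor[OF A B \<xi>] adj_distributor[OF A B \<xi>']
  have "arrow_le (ty B b) (ty A a) (\<xi> (b, a)) (\<xi>' (b, a))" if "b \<in> ob B" "a \<in> ob A" for b a
  proof (rule adj_unit_le_into[OF A B \<xi>'])
    fix b' assume b': "b' \<in> ob B"
    show "arrow_le (ty B b) (ty A a) (qcomp Q (ty B b) (ty B b') (ty A a) (\<xi>' (b', a))
        (qcomp Q (ty B b) (ty A a) (ty B b') (\<zeta> (a, b')) (\<xi> (b, a)))) (\<xi>' (b, a))"
      using that b' d
      by (intro arrow_le_comp_trans[OF adj_counit[OF A B \<xi>]] distributor_right distributor_arrow)
  qed (use that d in \<open>auto intro: distributor_arrow\<close>)
  then show ?thesis using d by (simp add: distributor_le_iff)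
qed

lemma right_adj_eq:
  assumes "q_category Q A" "q_category Q B" "dist_adj Q A B \<zeta> \<xi>"
  shows "right_adj Q A B \<zeta> = \<xi>"
  unfolding right_adj_def
proof (rule the_equality)
  show "\<xi>' = \<xi>" if "dist_adj Q A B \<zeta> \<xi>'" for \<xi>'
    using assms that adj_distributor(2)[of A B \<zeta>]
    by (intro distributor_antisym right_adjoint_le)
qed fact

section \<open>Implications of distributors\<close>

context
  fixes A :: "('o, 'q, 'c) qcat" and B :: "('o, 'q, 'd) qcat" and C :: "('o, 'q, 'e) qcat"
    and \<phi> \<theta>
  assumes \<phi>: "distributor A B \<phi>" and \<theta>: "distributor A C \<theta>"
begin

text \<open>
  The implication is computed one pair \<open>(y, z)\<close> at a time.  This family satisfies the universal
  property because composition with \<open>\<phi> (x, y)\<close> preserves the join.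
\<close>

private definition largest where
  "largest = (\<lambda>(y, z) \<in> ob B \<times> ob C. \<Squnion>\<^bsub>homs Q (ty B y) (ty C z)\<^esub>
     {k. arrow (ty B y) (ty C z) k \<and> (\<forall>x \<in> ob A. arrow_le (ty A x) (ty C z)
       (qcomp Q (ty A x) (ty B y) (ty C z) k (\<phi> (x, y))) (\<theta> (x, z)))})"

private lemma limp_ty: "y \<in> ob B \<Longrightarrow> ty B y \<in> objs Q" "z \<in> ob C \<Longrightarrow> ty C z \<in> objs Q"
  using \<phi> \<theta> by (auto simp: distributor_def q_category.ty_closed)

private lemma largest_arrow:
  "y \<in> ob B \<Longrightarrow> z \<in> ob C \<Longrightarrow> arrow (ty B y) (ty C z) (largest (y, z))"
  by (auto simp: largest_def limp_ty intro: arrow_join)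

private lemma largest_comp:
  assumes "x \<in> ob A" "y \<in> ob B" "z \<in> ob C"
  shows "arrow_le (ty A x) (ty C z)
    (qcomp Q (ty A x) (ty B y) (ty C z) (largest (y, z)) (\<phi> (x, y))) (\<theta> (x, z))"
  using assms \<phi> \<theta> by (auto simp: largest_def intro!: join_comp_le distributor_arrow)

private lemma le_largest:
  assumes "y \<in> ob B" "z \<in> ob C" "arrow (ty B y) (ty C z) k"
  shows "arrow_le (ty B y) (ty C z) k (largest (y, z)) \<longleftrightarrow> (\<forall>x \<in> ob A. arrow_le (ty A x) (ty C z)
       (qcomp Q (ty A x) (ty B y) (ty C z) k (\<phi> (x, y))) (\<theta> (x, z)))"
    (is "?L \<longleftrightarrow> ?R")
proof
  show ?R if ?L
    using that assms \<phi> by (blast intro: arrow_le_comp_trans' largest_comp distributor_arrow)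
  show ?L if ?R
    using that assms by (auto simp: largest_def intro: arrow_le_join)
qed

private lemma largest_distributor: "distributor B C largest"
proof (rule distributorI)
  show B: "q_category Q B" and C: "q_category Q C" using \<phi> \<theta> by (auto simp: distributor_def)
  show "largest \<in> extensional (ob B \<times> ob C)" by (simp add: largest_def)
  show "arrow (ty B y) (ty C z) (largest (y, z))" if "y \<in> ob B" "z \<in> ob C" for y z
    by (rule largest_arrow) fact+
  show "arrow_le (ty B y) (ty C z)
      (qcomp Q (ty B y) (ty C z') (ty C z) (arr C z' z) (largest (y, z'))) (largest (y, z))"
    if "y \<in> ob B" "z' \<in> ob C" "z \<in> ob C" for y z' z
  proof (subst le_largest, safe)
    fix x assume x: "x \<in> ob A"
    have "arrow_le (ty A x) (ty C z) (qcomp Q (ty A x) (ty C z') (ty C z) (arr C z' z)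
        (qcomp Q (ty A x) (ty B y) (ty C z') (largest (y, z')) (\<phi> (x, y)))) (\<theta> (x, z))"
      using that x C \<theta> by (intro arrow_le_comp_trans[OF largest_comp] hom_arrow distributor_left)
    then show "arrow_le (ty A x) (ty C z) (qcomp Q (ty A x) (ty B y) (ty C z)
        (qcomp Q (ty B y) (ty C z') (ty C z) (arr C z' z) (largest (y, z'))) (\<phi> (x, y))) (\<theta> (x, z))"
      using that x C \<phi>
      by (subst arrow_comp_assoc[symmetric]) (auto intro: distributor_arrow largest_arrow hom_arrow)
  qed (use that C in \<open>auto intro: arrow_comp largest_arrow hom_arrow\<close>)
  show "arrow_le (ty B y) (ty C z)
      (qcomp Q (ty B y) (ty B y') (ty C z) (largest (y', z)) (arr B y y')) (largest (y, z))"
    if "y \<in> ob B" "y' \<in> ob B" "z \<in> ob C" for y y' z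
  proof (subst le_largest, safe)
    fix x assume x: "x \<in> ob A"
    have "arrow_le (ty A x) (ty C z) (qcomp Q (ty A x) (ty B y') (ty C z) (largest (y', z))
        (qcomp Q (ty A x) (ty B y) (ty B y') (arr B y y') (\<phi> (x, y)))) (\<theta> (x, z))"
      using that x \<phi>
      by (intro arrow_le_comp_trans[OF distributor_left] largest_comp largest_arrow)
    then show "arrow_le (ty A x) (ty C z) (qcomp Q (ty A x) (ty B y) (ty C z)
        (qcomp Q (ty B y) (ty B y') (ty C z) (largest (y', z)) (arr B y y')) (\<phi> (x, y))) (\<theta> (x, z))"
      using that x B \<phi>
      by (subst arrow_comp_assoc[symmetric]) (auto intro: distributor_arrow largest_arrow hom_arrow)
  qed (use that B in \<open>auto intro: arrow_comp largest_arrow hom_arrow\<close>)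
qed

private lemma dist_limp_eq_largest: "dist_limp Q A B C \<theta> \<phi> = largest"
proof -
  have dist: "\<kappa> \<in> dist Q B C \<longleftrightarrow> distributor B C \<kappa>" for \<kappa>
    using \<phi> \<theta> by (auto simp: distributor_def)
  have univ: "dist_le Q A C (dist_comp Q A B C \<psi> \<phi>) \<theta> \<longleftrightarrow> dist_le Q B C \<psi> largest"
    (is "?L \<longleftrightarrow> ?R") if \<psi>: "distributor B C \<psi>" for \<psi>
  proof -
    have "?R \<longleftrightarrow> (\<forall>y \<in> ob B. \<forall>z \<in> ob C. \<forall>x \<in> ob A. arrow_le (ty A x) (ty C z)
       (qcomp Q (ty A x) (ty B y) (ty C z) (\<psi> (y, z)) (\<phi> (x, y))) (\<theta> (x, z)))"
      using \<psi> by (simp add: distributor_le_iff largest_distributor le_largest distributor_arrow)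
    also have "\<dots> \<longleftrightarrow> ?L"
      unfolding distributor_le_iff[OF distributor_comp[OF \<phi> \<psi>] \<theta>]
    proof safe
      fix x z assume *: "\<forall>y \<in> ob B. \<forall>z \<in> ob C. \<forall>x \<in> ob A. arrow_le (ty A x) (ty C z)
         (qcomp Q (ty A x) (ty B y) (ty C z) (\<psi> (y, z)) (\<phi> (x, y))) (\<theta> (x, z))"
        and "x \<in> ob A" "z \<in> ob C"
      then show "arrow_le (ty A x) (ty C z) (dist_comp Q A B C \<psi> \<phi> (x, z)) (\<theta> (x, z))"
        using \<theta> by (intro dist_comp_le[OF \<phi> \<psi>] distributor_arrow) auto
    next
      fix x y z
      assume "\<forall>x\<in>ob A. \<forall>z\<in>ob C. arrow_le (ty A x) (ty C z) (dist_comp Q A B C \<psi> \<phi> (x, z)) (\<theta> (x, z))"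
        and "x \<in> ob A" "y \<in> ob B" "z \<in> ob C"
      then show "arrow_le (ty A x) (ty C z)
         (qcomp Q (ty A x) (ty B y) (ty C z) (\<psi> (y, z)) (\<phi> (x, y))) (\<theta> (x, z))"
        using le_dist_comp[OF \<phi> \<psi>] arrow_le_trans by blast
    qed
    finally show ?thesis by blast
  qed
  have refl: "dist_le Q B C \<kappa> \<kappa>" if "distributor B C \<kappa>" for \<kappa>
    using that by (auto simp: distributor_le_iff intro: arrow_le_refl distributor_arrow)
  show ?thesis
    unfolding dist_limp_def
  proof (rule the_equality)
    show "largest \<in> dist Q B C \<and> (\<forall>\<psi> \<in> dist Q B C.
        dist_le Q A C (dist_comp Q A B C \<psi> \<phi>) \<theta> \<longleftrightarrow> dist_le Q B C \<psi> largest)"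
      using largest_distributor univ by (auto simp: dist)
    show "\<kappa> = largest" if "\<kappa> \<in> dist Q B C \<and> (\<forall>\<psi> \<in> dist Q B C.
        dist_le Q A C (dist_comp Q A B C \<psi> \<phi>) \<theta> \<longleftrightarrow> dist_le Q B C \<psi> \<kappa>)" for \<kappa>
      using that largest_distributor univ refl
      by (intro distributor_antisym[of B C]) (auto simp: dist)
  qed
qed

lemma distributor_limp: "distributor B C (dist_limp Q A B C \<theta> \<phi>)"
  by (simp add: dist_limp_eq_largest largest_distributor)

lemma dist_limp_comp_le:
  "x \<in> ob A \<Longrightarrow> y \<in> ob B \<Longrightarrow> z \<in> ob C \<Longrightarrow> arrow_le (ty A x) (ty C z)
    (qcomp Q (ty A x) (ty B y) (ty C z) (dist_limp Q A B C \<theta> \<phi> (y, z)) (\<phi> (x, y))) (\<theta> (x, z))"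
  by (simp add: dist_limp_eq_largest largest_comp)

lemma le_dist_limp_iff:
  assumes "y \<in> ob B" "z \<in> ob C" "arrow (ty B y) (ty C z) k"
  shows "arrow_le (ty B y) (ty C z) k (dist_limp Q A B C \<theta> \<phi> (y, z)) \<longleftrightarrow>
    (\<forall>x \<in> ob A. arrow_le (ty A x) (ty C z)
       (qcomp Q (ty A x) (ty B y) (ty C z) k (\<phi> (x, y))) (\<theta> (x, z)))"
  using le_largest[OF assms] by (simp add: dist_limp_eq_largest)

end

section \<open>Presheaves\<close>

lemma q_category_star: "X \<in> objs Q \<Longrightarrow> q_category Q (star Q X)"
  by (rule q_categoryI)
    (auto simp: star_def arrow_comp_ident arrow_ident intro: arrow_le_refl)

lemma star_simps [simp]: "ob (star Q X) = {()}" "ty (star Q X) x = X" "arr (star Q X) x y = ident Q X"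
  by (auto simp: star_def)

lemma psh_simps [simp]:
  "ob (psh Q A) = (SIGMA X : objs Q. dist Q A (star Q X))" "ty (psh Q A) = fst"
  "arr (psh Q A) p p' = dist_limp Q A (star Q (fst p)) (star Q (fst p')) (snd p') (snd p) ((), ())"
  by (auto simp: psh_def split: prod.splits)

context
  fixes A :: "('o, 'q, 'c) qcat"
  assumes A: "q_category Q A"
begin

lemma presheaf_iff:
  "p \<in> ob (psh Q A) \<longleftrightarrow> fst p \<in> objs Q \<and> distributor A (star Q (fst p)) (snd p)"
  using A by (cases p) (auto simp: distributor_def q_category_star)

lemma presheaf_arrow:
  "p \<in> ob (psh Q A) \<Longrightarrow> a \<in> ob A \<Longrightarrow> arrow (ty A a) (fst p) (snd p (a, ()))"
  using distributor_arrow[of A "star Q (fst p)" "snd p" a "()"] by (auto simp: presheaf_iff simp del: psh_simps)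

lemma presheaf_hom_arrow:
  "p \<in> ob (psh Q A) \<Longrightarrow> p' \<in> ob (psh Q A) \<Longrightarrow> arrow (fst p) (fst p') (arr (psh Q A) p p')"
  using distributor_arrow[OF distributor_limp[of A "star Q (fst p)" "snd p" "star Q (fst p')" "snd p'"], of "()" "()"]
  by (simp add: presheaf_iff del: psh_simps(1))

lemma le_presheaf_hom_iff:
  assumes "p \<in> ob (psh Q A)" "p' \<in> ob (psh Q A)" "arrow (fst p) (fst p') k"
  shows "arrow_le (fst p) (fst p') k (arr (psh Q A) p p') \<longleftrightarrow>
    (\<forall>a \<in> ob A. arrow_le (ty A a) (fst p')
      (qcomp Q (ty A a) (fst p) (fst p') k (snd p (a, ()))) (snd p' (a, ())))"
  using le_dist_limp_iff[of A "star Q (fst p)" "snd p" "star Q (fst p')" "snd p'" "()" "()" k] assms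
  by (simp add: presheaf_iff del: psh_simps(1))

lemma presheaf_hom_comp:
  assumes "p \<in> ob (psh Q A)" "p' \<in> ob (psh Q A)" "a \<in> ob A"
  shows "arrow_le (ty A a) (fst p')
      (qcomp Q (ty A a) (fst p) (fst p') (arr (psh Q A) p p') (snd p (a, ()))) (snd p' (a, ()))"
  using le_presheaf_hom_iff[OF assms(1,2) presheaf_hom_arrow[OF assms(1,2)]] assms
    arrow_le_refl[OF presheaf_hom_arrow[OF assms(1,2)]] by blast

lemma q_category_psh: "q_category Q (psh Q A)"
proof (rule q_categoryI, unfold psh_simps(2))
  show "fst p \<in> objs Q" if "p \<in> ob (psh Q A)" for p
    using that by (auto simp: presheaf_iff simp del: psh_simps)
  show "arrow (fst p) (fst p') (arr (psh Q A) p p')"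
    if "p \<in> ob (psh Q A)" "p' \<in> ob (psh Q A)" for p p'
    using that by (rule presheaf_hom_arrow)
  show "arrow_le (fst p) (fst p) (ident Q (fst p)) (arr (psh Q A) p p)"
    if "p \<in> ob (psh Q A)" for p
    using that presheaf_arrow[OF that]
    by (subst le_presheaf_hom_iff)
      (auto simp: arrow_comp_ident simp del: psh_simps(3) intro: arrow_le_refl arrow_ident)
  show "arrow_le (fst p) (fst r)
      (qcomp Q (fst p) (fst q) (fst r) (arr (psh Q A) q r) (arr (psh Q A) p q)) (arr (psh Q A) p r)"
    if "p \<in> ob (psh Q A)" "q \<in> ob (psh Q A)" "r \<in> ob (psh Q A)" for p q r
  proof (subst le_presheaf_hom_iff, safe)
    fix a assume a: "a \<in> ob A"
    show "arrow_le (ty A a) (fst r) (qcomp Q (ty A a) (fst p) (fst r)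
        (qcomp Q (fst p) (fst q) (fst r) (arr (psh Q A) q r) (arr (psh Q A) p q)) (snd p (a, ())))
        (snd r (a, ()))"
      unfolding arrow_comp_assoc[OF presheaf_arrow[OF that(1) a] presheaf_hom_arrow[OF that(1,2)]
          presheaf_hom_arrow[OF that(2,3)], symmetric]
      using that a
      by (intro arrow_le_comp_trans[OF presheaf_hom_comp] presheaf_hom_comp presheaf_hom_arrow)
  qed (use that in \<open>blast intro: arrow_comp presheaf_hom_arrow\<close>)+
qed

text \<open>The presheaf \<open>\<phi>(-,b)\<close>; representable presheaves are the columns of the identity.\<close>

definition column :: "('o, 'q, 'd) qcat \<Rightarrow> ('c \<times> 'd \<Rightarrow> 'q) \<Rightarrow> 'd \<Rightarrow> ('o, 'q, 'c) presheaf" where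
  "column B \<phi> b = (ty B b, \<lambda>(x, _) \<in> ob A \<times> {()}. \<phi> (x, b))"

lemma column_simps [simp]:
  "fst (column B \<phi> b) = ty B b" "x \<in> ob A \<Longrightarrow> snd (column B \<phi> b) (x, ()) = \<phi> (x, b)"
  by (auto simp: column_def)

lemma column_in_psh:
  assumes "distributor A B \<phi>" "b \<in> ob B"
  shows "column B \<phi> b \<in> ob (psh Q A)"
proof -
  have X: "ty B b \<in> objs Q" using assms by (auto simp: distributor_def q_category.ty_closed)
  have "distributor A (star Q (ty B b)) (\<lambda>(x, _) \<in> ob A \<times> {()}. \<phi> (x, b))"
    using assms X A
    by (intro distributorI)
      (auto simp: arrow_comp_ident[OF distributor_arrow[OF assms(1) _ assms(2)]]
        intro: q_category_star distributor_arrow distributor_right arrow_le_refl)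
  then show ?thesis using X by (simp add: presheaf_iff column_def del: psh_simps)
qed

lemma yoneda_eq_column: "a \<in> ob A \<Longrightarrow> yoneda A a = column A (dist_id A) a"
  by (auto simp: yoneda_def column_def dist_id_def restrict_def fun_eq_iff)

lemma yoneda_in_psh: "a \<in> ob A \<Longrightarrow> yoneda A a \<in> ob (psh Q A)"
  using column_in_psh[OF distributor_id[OF A]] by (simp only: yoneda_eq_column)

lemma yoneda_simps [simp]:
  "fst (yoneda A a) = ty A a" "x \<in> ob A \<Longrightarrow> snd (yoneda A a) (x, ()) = arr A x a"
  by (auto simp: yoneda_def)

end

text \<open>
  A form of the Yoneda lemma: the join over \<open>c\<close> of \<open>C(c, G y) \<circ> C(F x, c)\<close> is attained at
  \<open>c = G y\<close>.
\<close>

lemma cograph_comp_graph: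
  assumes C: "q_category Q C"
    and F: "\<And>x. x \<in> ob A \<Longrightarrow> F x \<in> ob C \<and> ty C (F x) = ty A x"
    and G: "\<And>y. y \<in> ob B \<Longrightarrow> G y \<in> ob C \<and> ty C (G y) = ty B y"
    and x: "x \<in> ob A" and y: "y \<in> ob B"
  shows "dist_comp Q A C B (cograph B C G) (graph A C F) (x, y) = arr C (F x) (G y)"
proof -
  let ?S = "(\<lambda>c. qcomp Q (ty A x) (ty C c) (ty B y) (arr C c (G y)) (arr C (F x) c)) ` ob C"
  have tr: "arrow_le (ty A x) (ty B y) s (arr C (F x) (G y))" if "s \<in> ?S" for s
  proof -
    from that obtain c where c: "c \<in> ob C"
      and s: "s = qcomp Q (ty A x) (ty C c) (ty B y) (arr C c (G y)) (arr C (F x) c)" by blast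
    show ?thesis using hom_trans[OF C, of "F x" c "G y"] c F[OF x] G[OF y] by (simp add: s)
  qed
  have ho: "arrow (ty A x) (ty B y) (arr C (F x) (G y))"
    using hom_arrow[OF C, of "F x" "G y"] F[OF x] G[OF y] by simp
  have "arrow_le (ty A x) (ty B y) (qcomp Q (ty A x) (ty B y) (ty B y) (ident Q (ty B y)) (arr C (F x) (G y)))
     (qcomp Q (ty A x) (ty B y) (ty B y) (arr C (G y) (G y)) (arr C (F x) (G y)))"
    using hom_refl[OF C, of "G y"] G[OF y] ho by (intro arrow_comp_mono arrow_le_refl) auto
  also have "arrow_le (ty A x) (ty B y) \<dots> (\<Squnion>\<^bsub>homs Q (ty A x) (ty B y)\<^esub> ?S)"
    using G[OF y] by (intro arrow_le_join arrow_leD(1)[OF tr]) (auto intro!: image_eqI[of _ _ "G y"])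
  finally have "arr C (F x) (G y) = \<Squnion>\<^bsub>homs Q (ty A x) (ty B y)\<^esub> ?S"
    using ho tr by (intro arrow_le_antisym[OF _ join_arrow_le]) (auto simp: arrow_comp_ident)
  then show ?thesis
    using x y by (simp add: dist_comp_def graph_def cograph_def)
qed

lemma distributor_cograph:
  assumes A: "q_category Q A" and C: "q_category Q C"
    and F: "\<And>x. x \<in> ob A \<Longrightarrow> F x \<in> ob C \<and> ty C (F x) = ty A x"
    and F_hom: "\<And>x x'. x \<in> ob A \<Longrightarrow> x' \<in> ob A \<Longrightarrow>
      arrow_le (ty A x) (ty A x') (arr A x x') (arr C (F x) (F x'))"
  shows "distributor C A (cograph A C F)"
proof (rule distributorI)
  have hom: "arrow (ty C y) (ty A x) (arr C y (F x))" if "y \<in> ob C" "x \<in> ob A" for x y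
    using hom_arrow[OF C, of y "F x"] that F[of x] by simp
  show "arrow (ty C y) (ty A x) (cograph A C F (y, x))" if "y \<in> ob C" "x \<in> ob A" for y x
    using hom that by (simp add: cograph_def)
  show "arrow_le (ty C y) (ty A x)
      (qcomp Q (ty C y) (ty A x') (ty A x) (arr A x' x) (cograph A C F (y, x'))) (cograph A C F (y, x))"
    if "y \<in> ob C" "x' \<in> ob A" "x \<in> ob A" for y x' x
  proof -
    have "arrow_le (ty C y) (ty A x) (qcomp Q (ty C y) (ty A x') (ty A x) (arr A x' x) (arr C y (F x')))
        (arr C y (F x))"
      using that F hom_trans[OF C, of y "F x'" "F x"]
      by (intro arrow_le_comp_trans'[OF F_hom]) (auto intro: hom)
    then show ?thesis using that by (simp add: cograph_def)
  qed
  show "arrow_le (ty C y) (ty A x)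
      (qcomp Q (ty C y) (ty C y') (ty A x) (cograph A C F (y', x)) (arr C y y')) (cograph A C F (y, x))"
    if "y \<in> ob C" "y' \<in> ob C" "x \<in> ob A" for y y' x
    using that F[of x] hom_trans[OF C, of y y' "F x"] by (simp add: cograph_def)
qed (auto simp: cograph_def A C)

lemma distributor_yoneda_cograph:
  assumes A: "q_category Q A"
  shows "distributor (psh Q A) A (cograph A (psh Q A) (yoneda A))"
proof (rule distributor_cograph[OF A q_category_psh[OF A]])
  show "yoneda A x \<in> ob (psh Q A) \<and> ty (psh Q A) (yoneda A x) = ty A x" if "x \<in> ob A" for x
    using yoneda_in_psh[OF A that] yoneda_simps(1)[OF A] by (simp del: psh_simps(1))
  show "arrow_le (ty A x) (ty A x') (arr A x x') (arr (psh Q A) (yoneda A x) (yoneda A x'))"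
    if "x \<in> ob A" "x' \<in> ob A" for x x'
    using le_presheaf_hom_iff[OF A yoneda_in_psh[OF A that(1)] yoneda_in_psh[OF A that(2)], of "arr A x x'"]
      that hom_trans[OF A] hom_arrow[OF A that]
    by (simp add: yoneda_simps[OF A] del: psh_simps)
qed

section \<open>The homomorphism equation\<close>

context
  fixes A :: "('o, 'q, 'c) qcat" and B :: "('o, 'q, 'd) qcat" and \<zeta> \<xi>
  assumes A: "q_category Q A" and B: "q_category Q B" and adj: "dist_adj Q A B \<zeta> \<xi>"
begin

lemma psh_push_in_psh:
  assumes "p \<in> ob (psh Q A)"
  shows "psh_push Q A B \<zeta> p \<in> ob (psh Q B)"
  using assms distributor_comp[OF adj_distributor(2)[OF A B adj], of "star Q (fst p)" "snd p"]
  by (simp add: presheaf_iff[OF A] presheaf_iff[OF B] psh_push_def right_adj_eq[OF A B adj]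
      case_prod_beta del: psh_simps)

text \<open>
  Let \<open>\<mu>\<close> be the distributor of \<open>p\<close>.  By \<open>\<zeta> \<stileturn> \<xi>\<close>, the inequalities \<open>k \<circ> \<mu> \<circ> \<xi> \<le> B(-,b)\<close> and \<open>k \<circ> \<mu> \<le> \<zeta>(-,b)\<close> are equivalent:
  compose the first with \<open>\<zeta>\<close> and use the unit, compose the second with \<open>\<xi>\<close> and use the counit.
\<close>

lemma le_hom_psh_push_yoneda_iff:
  assumes p: "p \<in> ob (psh Q A)" and b: "b \<in> ob B" and k: "arrow (fst p) (ty B b) k"
  shows "arrow_le (fst p) (ty B b) k (arr (psh Q B) (psh_push Q A B \<zeta> p) (yoneda B b)) \<longleftrightarrow>
    (\<forall>a \<in> ob A. arrow_le (ty A a) (ty B b)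
      (qcomp Q (ty A a) (fst p) (ty B b) k (snd p (a, ()))) (\<zeta> (a, b)))"
    (is "?L \<longleftrightarrow> ?R")
proof -
  define \<mu> where "\<mu> = snd p"
  note d = adj_distributor[OF A B adj]
  have \<mu>: "distributor A (star Q (fst p)) \<mu>" using p by (simp add: presheaf_iff[OF A] \<mu>_def del: psh_simps)
  have \<mu>_arrow: "arrow (ty A a) (fst p) (\<mu> (a, ()))" if "a \<in> ob A" for a
    using presheaf_arrow[OF A p that] by (simp add: \<mu>_def)
  let ?m = "dist_comp Q B A (star Q (fst p)) \<mu> \<xi>"
  have push: "psh_push Q A B \<zeta> p = (fst p, ?m)"
    by (simp add: psh_push_def right_adj_eq[OF A B adj] case_prod_beta \<mu>_def)
  have "?L \<longleftrightarrow> (\<forall>b' \<in> ob B. arrow_le (ty B b') (ty B b)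
      (qcomp Q (ty B b') (fst p) (ty B b) k (?m (b', ()))) (arr B b' b))"
    using le_presheaf_hom_iff[OF B psh_push_in_psh[OF p] yoneda_in_psh[OF B b], of k] k
    by (simp add: push yoneda_simps[OF B] del: psh_simps)
  also have "\<dots> \<longleftrightarrow> ?R"
  proof safe
    fix b' assume R: ?R and b': "b' \<in> ob B"
    have "arrow_le (ty B b') (ty B b) (qcomp Q (ty B b') (ty A a) (ty B b)
        (qcomp Q (ty A a) (fst p) (ty B b) k (\<mu> (a, ()))) (\<xi> (b', a))) (arr B b' b)"
      if a: "a \<in> ob A" for a
      using R by (intro arrow_le_comp_trans'[OF _ distributor_arrow[OF d(2) b' a]
            adj_counit[OF A B adj a b' b]]) (simp add: \<mu>_def a)
    then show "arrow_le (ty B b') (ty B b)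
        (qcomp Q (ty B b') (fst p) (ty B b) k (?m (b', ()))) (arr B b' b)"
      by (rule comp_dist_comp_le[OF d(2) \<mu> b', unfolded star_simps, OF singletonI k hom_arrow[OF B b' b]])
  next
    fix a assume a: "a \<in> ob A"
      and L: "\<forall>b' \<in> ob B. arrow_le (ty B b') (ty B b)
        (qcomp Q (ty B b') (fst p) (ty B b) k (?m (b', ()))) (arr B b' b)"
    have "arrow_le (ty A a) (ty B b) (qcomp Q (ty A a) (fst p) (ty B b) k (\<mu> (a, ()))) (\<zeta> (a, b))"
    proof (rule adj_unit_le_out[OF A B adj a])
      fix b' assume b': "b' \<in> ob B"
      have "arrow_le (ty B b') (ty B b) (qcomp Q (ty B b') (fst p) (ty B b) k
          (qcomp Q (ty B b') (ty A a) (fst p) (\<mu> (a, ())) (\<xi> (b', a)))) (arr B b' b)"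
        using L b'
        by (intro arrow_le_comp_trans[OF le_dist_comp[OF d(2) \<mu> b' a, unfolded star_simps, OF singletonI] k])
          blast
      then have "arrow_le (ty B b') (ty B b) (qcomp Q (ty B b') (ty A a) (ty B b)
          (qcomp Q (ty A a) (fst p) (ty B b) k (\<mu> (a, ()))) (\<xi> (b', a))) (arr B b' b)"
        by (simp add: arrow_comp_assoc[OF distributor_arrow[OF d(2) b' a] \<mu>_arrow[OF a] k])
      then show "arrow_le (ty A a) (ty B b) (qcomp Q (ty A a) (ty B b') (ty B b)
          (qcomp Q (ty B b') (ty A a) (ty B b)
            (qcomp Q (ty A a) (fst p) (ty B b) k (\<mu> (a, ()))) (\<xi> (b', a))) (\<zeta> (a, b'))) (\<zeta> (a, b))"
        by (rule arrow_le_comp_trans'[OF _ distributor_arrow[OF d(1) a b']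
              distributor_left[OF d(1) a b' b]])
    qed (use a b d k \<mu>_arrow in \<open>auto intro: arrow_comp distributor_arrow\<close>)
    then show "arrow_le (ty A a) (ty B b)
        (qcomp Q (ty A a) (fst p) (ty B b) k (snd p (a, ()))) (\<zeta> (a, b))"
      by (simp add: \<mu>_def)
  qed
  finally show ?thesis .
qed

private abbreviation "via_B \<equiv>
  dist_comp Q (psh Q A) (psh Q B) B (cograph B (psh Q B) (yoneda B)) (psh_map Q A B \<zeta>)"

private abbreviation "via_A \<equiv> dist_comp Q (psh Q A) A B \<zeta> (cograph A (psh Q A) (yoneda A))"

private lemma via_B_eq:
  assumes p: "p \<in> ob (psh Q A)" and b: "b \<in> ob B"
  shows "via_B (p, b) = arr (psh Q B) (psh_push Q A B \<zeta> p) (yoneda B b)"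
  unfolding psh_map_def
  by (rule cograph_comp_graph[OF q_category_psh[OF B] _ _ p b])
    (auto simp: yoneda_simps[OF B] psh_push_def case_prod_beta simp del: psh_simps(1)
      intro: psh_push_in_psh[unfolded psh_push_def case_prod_beta] yoneda_in_psh[OF B])

private lemma via_B_arrow:
  assumes "p \<in> ob (psh Q A)" "b \<in> ob B"
  shows "arrow (fst p) (ty B b) (via_B (p, b))"
  using presheaf_hom_arrow[OF B psh_push_in_psh[OF assms(1)] yoneda_in_psh[OF B assms(2)]] assms
  by (simp add: via_B_eq yoneda_simps[OF B] psh_push_def case_prod_beta del: psh_simps)

private lemma le_via_B_iff:
  assumes "p \<in> ob (psh Q A)" "b \<in> ob B" "arrow (fst p) (ty B b) k"
  shows "arrow_le (fst p) (ty B b) k (via_B (p, b)) \<longleftrightarrow>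
    (\<forall>a \<in> ob A. arrow_le (ty A a) (ty B b)
      (qcomp Q (ty A a) (fst p) (ty B b) k (snd p (a, ()))) (\<zeta> (a, b)))"
  using le_hom_psh_push_yoneda_iff[OF assms] assms by (simp add: via_B_eq del: psh_simps)

text \<open>
  The inequality \<open>\<zeta> \<circ> (A \<swarrow> \<mu>) \<le> \<zeta> \<swarrow> \<mu>\<close>, valid because
  \<open>\<zeta> \<circ> (A \<swarrow> \<mu>) \<circ> \<mu> \<le> \<zeta> \<circ> A \<le> \<zeta>\<close>.
\<close>

private lemma via_A_le_via_B:
  assumes p: "p \<in> ob (psh Q A)" and b: "b \<in> ob B"
  shows "arrow_le (fst p) (ty B b) (via_A (p, b)) (via_B (p, b))"
proof -
  note d = adj_distributor[OF A B adj] distributor_yoneda_cograph[OF A]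
  have "arrow_le (fst p) (ty B b) (qcomp Q (fst p) (ty A a) (ty B b) (\<zeta> (a, b))
      (cograph A (psh Q A) (yoneda A) (p, a))) (via_B (p, b))" if a: "a \<in> ob A" for a
  proof (subst le_via_B_iff[OF p b], safe)
    have hom: "arrow (fst p) (ty A a) (arr (psh Q A) p (yoneda A a))"
      using presheaf_hom_arrow[OF A p yoneda_in_psh[OF A a]] by (simp add: yoneda_simps[OF A] del: psh_simps)
    show "arrow (fst p) (ty B b) (qcomp Q (fst p) (ty A a) (ty B b) (\<zeta> (a, b))
        (cograph A (psh Q A) (yoneda A) (p, a)))"
      using hom p a b d(1) by (auto simp: cograph_def simp del: psh_simps intro: arrow_comp distributor_arrow)
    fix x assume x: "x \<in> ob A"
    have "arrow_le (ty A x) (ty A a)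
        (qcomp Q (ty A x) (fst p) (ty A a) (arr (psh Q A) p (yoneda A a)) (snd p (x, ()))) (arr A x a)"
      using presheaf_hom_comp[OF A p yoneda_in_psh[OF A a] x] x
      by (simp add: yoneda_simps[OF A] del: psh_simps)
    then have "arrow_le (ty A x) (ty B b) (qcomp Q (ty A x) (ty A a) (ty B b) (\<zeta> (a, b))
        (qcomp Q (ty A x) (fst p) (ty A a) (arr (psh Q A) p (yoneda A a)) (snd p (x, ())))) (\<zeta> (x, b))"
      by (rule arrow_le_comp_trans[OF _ distributor_arrow[OF d(1) a b] distributor_right[OF d(1) x a b]])
    then show "arrow_le (ty A x) (ty B b) (qcomp Q (ty A x) (fst p) (ty B b)
        (qcomp Q (fst p) (ty A a) (ty B b) (\<zeta> (a, b)) (cograph A (psh Q A) (yoneda A) (p, a)))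
        (snd p (x, ()))) (\<zeta> (x, b))"
      using p a
      by (simp add: cograph_def arrow_comp_assoc[OF presheaf_arrow[OF A p x] hom
            distributor_arrow[OF d(1) a b]] del: psh_simps)
  qed
  then show ?thesis
    using dist_comp_le[OF d(3,1) p b, of "via_B (p, b)"] via_B_arrow[OF p b] by (simp del: psh_simps(1,3))
qed

lemma psh_algebra_hom_iff:
  "psh_algebra_hom Q A B \<zeta> \<longleftrightarrow>
    (\<forall>p \<in> ob (psh Q A). \<forall>b \<in> ob B. arrow_le (fst p) (ty B b) (via_B (p, b)) (via_A (p, b)))"
proof -
  have "psh_algebra_hom Q A B \<zeta> \<longleftrightarrow> via_B = via_A"
    using adj by (auto simp: psh_algebra_hom_def left_adjoint_dist_def)
  also have "\<dots> \<longleftrightarrow>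
    (\<forall>p \<in> ob (psh Q A). \<forall>b \<in> ob B. arrow_le (fst p) (ty B b) (via_B (p, b)) (via_A (p, b)))"
  proof safe
    fix p b
    assume eq: "via_B = via_A" and "p \<in> ob (psh Q A)" "b \<in> ob B"
    then show "arrow_le (fst p) (ty B b) (via_B (p, b)) (via_A (p, b))"
      using arrow_le_refl[OF via_B_arrow[of p b]] by (simp only: eq)
  next
    assume *: "\<forall>p \<in> ob (psh Q A). \<forall>b \<in> ob B. arrow_le (fst p) (ty B b) (via_B (p, b)) (via_A (p, b))"
    show "via_B = via_A"
    proof (rule extensionalityI[where A = "ob (psh Q A) \<times> ob B"])
      fix q assume "q \<in> ob (psh Q A) \<times> ob B"
      then obtain p b where q: "q = (p, b)" "p \<in> ob (psh Q A)" "b \<in> ob B" by blast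
      then show "via_B q = via_A q"
        using * via_A_le_via_B arrow_le_antisym by blast
    qed (simp_all add: dist_comp_def)
  qed
  finally show ?thesis .
qed

text \<open>
  With \<open>k = \<zeta> \<swarrow> \<mu>\<close>, the counit of \<open>\<chi> \<stileturn> \<zeta>\<close> turns \<open>k \<circ> \<mu> \<le> \<zeta>\<close> into \<open>\<chi> \<circ> k \<le> A \<swarrow> \<mu>\<close>, and the
  unit gives \<open>k \<le> \<zeta> \<circ> \<chi> \<circ> k\<close>.
\<close>

lemma psh_algebra_hom_if_right_adjoint:
  assumes \<chi>: "dist_adj Q B A \<chi> \<zeta>"
  shows "psh_algebra_hom Q A B \<zeta>"
  unfolding psh_algebra_hom_iff
proof safe
  fix p b assume p: "p \<in> ob (psh Q A)" and b: "b \<in> ob B"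
  note d = adj_distributor[OF B A \<chi>] distributor_yoneda_cograph[OF A]
  define k where "k = via_B (p, b)"
  have k: "arrow (fst p) (ty B b) k" unfolding k_def by (rule via_B_arrow[OF p b])
  have k_comp: "arrow_le (ty A x) (ty B b) (qcomp Q (ty A x) (fst p) (ty B b) k (snd p (x, ()))) (\<zeta> (x, b))"
    if "x \<in> ob A" for x
    using le_via_B_iff[OF p b k] arrow_le_refl[OF k] that by (simp add: k_def del: psh_simps)
  have "arrow_le (fst p) (ty B b) k (via_A (p, b))"
  proof (rule adj_unit_le_into[OF B A \<chi> b k])
    show "arrow (fst p) (ty B b) (via_A (p, b))"
      using dist_comp_arrow[OF d(3,2) p b] by (simp del: psh_simps(1,3))
    fix a assume a: "a \<in> ob A"
    note \<chi>_arrow = distributor_arrow[OF d(1) b a]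
    have "arrow_le (fst p) (ty A a) (qcomp Q (fst p) (ty B b) (ty A a) (\<chi> (b, a)) k)
        (arr (psh Q A) p (yoneda A a))"
    proof -
      have "arrow_le (ty A x) (ty A a) (qcomp Q (ty A x) (fst p) (ty A a)
          (qcomp Q (fst p) (ty B b) (ty A a) (\<chi> (b, a)) k) (snd p (x, ()))) (arr A x a)"
        if x: "x \<in> ob A" for x
        unfolding arrow_comp_assoc[OF presheaf_arrow[OF A p x] k \<chi>_arrow, symmetric]
        by (rule arrow_le_comp_trans[OF k_comp[OF x] \<chi>_arrow adj_counit[OF B A \<chi> b x a]])
      then show ?thesis
        using le_presheaf_hom_iff[OF A p yoneda_in_psh[OF A a]] arrow_comp[OF k \<chi>_arrow]
        by (simp add: yoneda_simps[OF A] del: psh_simps)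
    qed
    moreover have "arrow_le (fst p) (ty B b) (qcomp Q (fst p) (ty A a) (ty B b) (\<zeta> (a, b))
        (arr (psh Q A) p (yoneda A a))) (via_A (p, b))"
      using le_dist_comp[OF d(3,2) p a b] p a by (simp add: cograph_def del: psh_simps(1,3))
    ultimately show "arrow_le (fst p) (ty B b) (qcomp Q (fst p) (ty A a) (ty B b) (\<zeta> (a, b))
        (qcomp Q (fst p) (ty B b) (ty A a) (\<chi> (b, a)) k)) (via_A (p, b))"
      using arrow_le_comp_trans distributor_arrow[OF d(2) a b] by blast
  qed
  then show "arrow_le (fst p) (ty B b) (via_B (p, b)) (via_A (p, b))" by (simp add: k_def)
qed

text \<open>
  Both arrows are the largest \<open>k\<close> with \<open>k \<circ> \<zeta>(x,b) \<le> A(x,a)\<close> for all \<open>x\<close>.  This identifies the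
  arrows in the homomorphism equation at the presheaf \<open>\<zeta>(-,b)\<close> with values of \<open>A \<swarrow> \<zeta>\<close>.
\<close>

lemma hom_column_yoneda:
  assumes a: "a \<in> ob A" and b: "b \<in> ob B"
  shows "arr (psh Q A) (column A B \<zeta> b) (yoneda A a) = dist_limp Q A B A (dist_id A) \<zeta> (b, a)"
proof -
  note d = adj_distributor(1)[OF A B adj] distributor_id[OF A]
  note limp = distributor_arrow[OF distributor_limp[OF d] b a]
  note c = column_in_psh[OF A d(1) b] yoneda_in_psh[OF A a]
  have hom: "arrow (ty B b) (ty A a) (arr (psh Q A) (column A B \<zeta> b) (yoneda A a))"
    using presheaf_hom_arrow[OF A c] by (simp add: column_simps[OF A] yoneda_simps[OF A] del: psh_simps)
  have "arrow_le (ty B b) (ty A a) k (arr (psh Q A) (column A B \<zeta> b) (yoneda A a)) \<longleftrightarrow>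
      arrow_le (ty B b) (ty A a) k (dist_limp Q A B A (dist_id A) \<zeta> (b, a))"
    if "arrow (ty B b) (ty A a) k" for k
    using le_presheaf_hom_iff[OF A c, of k] le_dist_limp_iff[OF d b a that] that a
    by (simp add: column_simps[OF A] yoneda_simps[OF A] dist_id_def del: psh_simps)
  then show ?thesis
    using hom limp by (blast intro: arrow_le_antisym arrow_le_refl)
qed

text \<open>
  The counit inequality is the defining property of the implication.  The unit inequality is
  first obtained on the diagonal, from the homomorphism equation at the presheaf \<open>\<zeta>(-,b)\<close>.
\<close>

lemma right_adjoint_if_psh_algebra_hom:
  assumes hom: "psh_algebra_hom Q A B \<zeta>"
  shows "dist_adj Q B A (dist_limp Q A B A (dist_id A) \<zeta>) \<zeta>"
proof -
  note d = adj_distributor(1)[OF A B adj] distributor_id[OF A] distributor_yoneda_cograph[OF A]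
  define \<chi> where "\<chi> = dist_limp Q A B A (dist_id A) \<zeta>"
  have \<chi>: "distributor B A \<chi>" unfolding \<chi>_def by (rule distributor_limp[OF d(1,2)])
  have comp: "distributor B B (dist_comp Q B A B \<zeta> \<chi>)" by (rule distributor_comp[OF \<chi> d(1)])
  have diag: "arrow_le (ty B b) (ty B b) (ident Q (ty B b)) (dist_comp Q B A B \<zeta> \<chi> (b, b))"
    if b: "b \<in> ob B" for b
  proof -
    let ?p = "column A B \<zeta> b"
    have p: "?p \<in> ob (psh Q A)" by (rule column_in_psh[OF A d(1) b])
    have id: "arrow (ty B b) (ty B b) (ident Q (ty B b))"
      by (rule arrow_ident[OF q_category.ty_closed[OF B b]])
    have "arrow_le (ty B b) (ty B b) (ident Q (ty B b)) (via_B (?p, b))"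
      using le_via_B_iff[OF p b, of "ident Q (ty B b)"] id
        arrow_comp_ident(1)[OF distributor_arrow[OF d(1) _ b]]
        arrow_le_refl[OF distributor_arrow[OF d(1) _ b]]
      by (simp add: column_simps[OF A] del: psh_simps)
    also have "arrow_le (ty B b) (ty B b) (via_B (?p, b)) (via_A (?p, b))"
      using hom p b by (auto simp: psh_algebra_hom_iff column_simps[OF A] simp del: psh_simps dest!: bspec[OF _ p])
    also have "arrow_le (ty B b) (ty B b) (via_A (?p, b)) (dist_comp Q B A B \<zeta> \<chi> (b, b))"
    proof -
      have "arrow_le (ty B b) (ty B b) (qcomp Q (ty B b) (ty A a) (ty B b) (\<zeta> (a, b))
          (cograph A (psh Q A) (yoneda A) (?p, a))) (dist_comp Q B A B \<zeta> \<chi> (b, b))"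
        if a: "a \<in> ob A" for a
        using le_dist_comp[OF \<chi> d(1) b a b] p a hom_column_yoneda[OF a b]
        by (simp add: cograph_def \<chi>_def del: psh_simps)
      then show ?thesis
        using dist_comp_le[OF d(3,1) p b, of "dist_comp Q B A B \<zeta> \<chi> (b, b)"] distributor_arrow[OF comp b b]
        by (simp add: column_simps[OF A] del: psh_simps(1,3))
    qed
    finally show ?thesis .
  qed
  (* Off the diagonal, the left action of B on a distributor reduces the bound to the diagonal one. *)
  have "dist_le Q B B (dist_id B) (dist_comp Q B A B \<zeta> \<chi>)"
    unfolding distributor_le_iff[OF distributor_id[OF B] comp]
  proof safe
    fix b b' assume b: "b \<in> ob B" and b': "b' \<in> ob B"
    have "arrow_le (ty B b) (ty B b') (qcomp Q (ty B b) (ty B b) (ty B b') (arr B b b') (ident Q (ty B b)))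
        (dist_comp Q B A B \<zeta> \<chi> (b, b'))"
      by (rule arrow_le_comp_trans[OF diag[OF b] hom_arrow[OF B b b'] distributor_left[OF comp b b b']])
    then show "arrow_le (ty B b) (ty B b') (dist_id B (b, b')) (dist_comp Q B A B \<zeta> \<chi> (b, b'))"
      using b b' by (simp add: dist_id_def arrow_comp_ident(2)[OF hom_arrow[OF B b b']])
  qed
  moreover have "dist_le Q A A (dist_comp Q A B A \<chi> \<zeta>) (dist_id A)"
    unfolding distributor_le_iff[OF distributor_comp[OF d(1) \<chi>] d(2)]
    unfolding \<chi>_def
    using d(1,2) distributor_limp[OF d(1,2)]
    by (auto intro!: dist_comp_le dist_limp_comp_le distributor_arrow)
  ultimately show ?thesis
    using d(1) \<chi> by (simp add: dist_adj_def distributor_def \<chi>_def)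
qed

end

end

section \<open>Homomorphisms and right adjoints\<close>

theorem proposition3p4:
  fixes Q :: "('o, 'q) quantaloid"
    and A :: "('o, 'q, 'a) qcat"
    and B :: "('o, 'q, 'b) qcat"
    and \<phi> :: "('o, 'q, 'a) presheaf \<times> 'a \<Rightarrow> 'q"
    and \<psi> :: "('o, 'q, 'b) presheaf \<times> 'b \<Rightarrow> 'q"
    and \<zeta> :: "'a \<times> 'b \<Rightarrow> 'q"
  assumes "quantaloid Q"
    and "psh_algebra Q A \<phi>"
    and "psh_algebra Q B \<psi>"
    and "left_adjoint_dist Q A B \<zeta>"
  shows "psh_algebra_hom Q A B \<zeta> \<longleftrightarrow> right_adjoint_dist Q A B \<zeta>"
proof -
  interpret quantaloid Q by fact
  have A: "q_category Q A" and B: "q_category Q B"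
    using assms(2,3) by (auto simp: psh_algebra_def)
  obtain \<xi> where \<xi>: "dist_adj Q A B \<zeta> \<xi>"
    using assms(4) by (auto simp: left_adjoint_dist_def)
  show ?thesis
    using psh_algebra_hom_if_right_adjoint[OF A B \<xi>] right_adjoint_if_psh_algebra_hom[OF A B \<xi>]
    unfolding right_adjoint_dist_def by blast
qed

end
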